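(* Let $\mathcal{F}$ be a non-negative regular integral summability method. Let $\{p_m\}_{m\ge 0}$ be a real sequence with $p_0>0$, $p_m\ge 0$ for all $m\ge1$ and $p_m>0$ for infinitely many $m$, such that the power series $p(y)=\sum_{m=0}^{\infty}p_m y^m$ has radius of convergence $\infty$, and let $P$ be the associated (non-polynomial Borel-type) power series method. Let $\{\Re_m\}_{m\ge 0}$ be a sequence of positive linear operators from $C_{*}[0,\infty)$ to $B_{*}[0,\infty)$ such that $$\sup_{y>0}\frac{1}{p(y)}\sum_{m=0}^{\infty}\left\Vert \Re_m\phi_0\right\Vert_\infty p_m y^m<\infty .$$ If, for each $\nu=0,1,2$, $$\lim_{s\to\infty}\left\Vert \mathcal{F}_{P,\Re}^{s}\phi_\nu-\phi_\nu\right\Vert_\infty=0,$$ then for every $\phi\in C_{*}[0,\infty)$, $$\lim_{s\to\infty}\left\Vert \mathcal{F}_{P,\Re}^{s}\phi-\phi\right\Vert_\infty=0 .$$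
   Context: $C_{*}[0,\infty)$ is the space of continuous real-valued functions $\phi$ on $[0,\infty)$ for which $\lim_{\xi\to\infty}\phi(\xi)$ exists (and is finite). $B_{*}[0,\infty)$ is the space of bounded real-valued functions on $[0,\infty)$ (not necessarily continuous) for which the limit at infinity exists. Both carry the norm $\|\phi\|_\infty=\sup_{\xi\ge 0}|\phi(\xi)|$. A linear operator is positive if it maps non-negative functions to non-negative functions. The test functions are $\phi_\nu(t)=e^{-\nu t}$, $\nu=0,1,2$. An integral summability method is given by a kernel $\mathcal{F}(s,y)$, $s,y\in[0,\infty)$, with $\mathcal{F}(s,\cdot)$ Lebesgue integrable on $[0,\infty)$ for each $s$; it sends a bounded measurable function $f$ on $[0,\infty)$ to $s\mapsto\int_0^\infty \mathcal{F}(s,y)f(y)\,dy$. It is non-negative if $\mathcal{F}(s,y)\ge 0$, and regular if $\lim_{y\to\infty}f(y)=L$ implies $\lim_{s\to\infty}\int_0^\infty\mathcal{F}(s,y)f(y)\,dy=L$ for every bounded measurable $f$; in particular $\lim_{s\to\infty}\int_0^\infty\mathcal{F}(s,y)\,dy=1$. For $y>0$, $\phi\in C_{*}[0,\infty)$ and $\xi\ge0$ put $$(\mathcal{V}_{P,\Re}^{y}\phi)(\xi)=\frac{1}{p(y)}\sum_{m=0}^{\infty}(\Re_m\phi)(\xi)\,p_m y^m ,$$ and for $s\in[0,\infty)$ put $$(\mathcal{F}_{P,\Re}^{s}\phi)(\xi)=\int_0^\infty \mathcal{F}(s,y)\,(\mathcal{V}_{P,\Re}^{y}\phi)(\xi)\,dy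 .$$ *)

theory Defs
  imports "HOL-Analysis.Analysis"
begin

(* A function on [0,\<infinity>) is represented by a function on the real line of which
   only the values on {0..} are constrained or used.  An operator satisfying
   positive_linear_op respects agreement on {0..}: if f and g agree there, then both
   f - g and g - f are non-negative on {0..}, so their images vanish on {0..}. *)

definition C_star :: "(real \<Rightarrow> real) set" where
  "C_star = {f. continuous_on {0..} f \<and> (\<exists>L. (f \<longlongrightarrow> L) at_top)}"

definition B_star :: "(real \<Rightarrow> real) set" where
  "B_star = {f. bounded (f ` {0..}) \<and> (\<exists>L. (f \<longlongrightarrow> L) at_top)}"

(* Only meaningful for functions bounded on {0..}. *)
definition sup_norm :: "(real \<Rightarrow> real) \<Rightarrow> real" where
  "sup_norm f = (SUP \<xi>\<in>{0..}. \<bar>f \<xi>\<bar>)"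

definition test_fun :: "nat \<Rightarrow> real \<Rightarrow> real" where
  "test_fun \<nu> t = exp (- real \<nu> * t)"

definition positive_linear_op :: "((real \<Rightarrow> real) \<Rightarrow> real \<Rightarrow> real) \<Rightarrow> bool" where
  "positive_linear_op T \<longleftrightarrow>
     (\<forall>f\<in>C_star. T f \<in> B_star) \<and>
     (\<forall>f\<in>C_star. \<forall>g\<in>C_star. \<forall>a b. \<forall>\<xi>\<ge>0.
        T (\<lambda>t. a * f t + b * g t) \<xi> = a * T f \<xi> + b * T g \<xi>) \<and>
     (\<forall>f\<in>C_star. (\<forall>t\<ge>0. f t \<ge> 0) \<longrightarrow> (\<forall>\<xi>\<ge>0. T f \<xi> \<ge> 0))"

definition integral_method_kernel :: "(real \<Rightarrow> real \<Rightarrow> real) \<Rightarrow> bool" where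
  "integral_method_kernel F \<longleftrightarrow> (\<forall>s\<ge>0. integrable (lebesgue_on {0..}) (F s))"

definition integral_method :: "(real \<Rightarrow> real \<Rightarrow> real) \<Rightarrow> (real \<Rightarrow> real) \<Rightarrow> real \<Rightarrow> real" where
  "integral_method F f s = (\<integral>y. F s y * f y \<partial>(lebesgue_on {0..}))"

definition nonnegative_method :: "(real \<Rightarrow> real \<Rightarrow> real) \<Rightarrow> bool" where
  "nonnegative_method F \<longleftrightarrow> (\<forall>s\<ge>0. \<forall>y\<ge>0. F s y \<ge> 0)"

definition regular_method :: "(real \<Rightarrow> real \<Rightarrow> real) \<Rightarrow> bool" where
  "regular_method F \<longleftrightarrow>
     (\<forall>f L. f \<in> borel_measurable (lebesgue_on {0..}) \<longrightarrow> bounded (f ` {0..}) \<longrightarrow>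
        (f \<longlongrightarrow> L) at_top \<longrightarrow> (integral_method F f \<longlongrightarrow> L) at_top)"

definition borel_type :: "(nat \<Rightarrow> real) \<Rightarrow> bool" where
  "borel_type p \<longleftrightarrow>
     p 0 > 0 \<and> (\<forall>m\<ge>1. p m \<ge> 0) \<and> infinite {m. p m > 0} \<and> conv_radius p = \<infinity>"

definition pseries :: "(nat \<Rightarrow> real) \<Rightarrow> real \<Rightarrow> real" where
  "pseries p y = (\<Sum>m. p m * y ^ m)"

definition V_op ::
  "(nat \<Rightarrow> real) \<Rightarrow> (nat \<Rightarrow> (real \<Rightarrow> real) \<Rightarrow> real \<Rightarrow> real) \<Rightarrow> real \<Rightarrow> (real \<Rightarrow> real) \<Rightarrow> real \<Rightarrow> real" where
  "V_op p R y \<phi> \<xi> = 1 / pseries p y * (\<Sum>m. R m \<phi> \<xi> * p m * y ^ m)"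

(* V_op is intended for y > 0; its value at y = 0 does not affect the integral. *)
definition F_op ::
  "(real \<Rightarrow> real \<Rightarrow> real) \<Rightarrow> (nat \<Rightarrow> real) \<Rightarrow> (nat \<Rightarrow> (real \<Rightarrow> real) \<Rightarrow> real \<Rightarrow> real) \<Rightarrow>
   real \<Rightarrow> (real \<Rightarrow> real) \<Rightarrow> real \<Rightarrow> real" where
  "F_op F p R s \<phi> \<xi> = integral_method F (\<lambda>y. V_op p R y \<phi> \<xi>) s"

end

theory Submission
  imports Defs
begin

text \<open>Korovkin's argument. After the substitution \<open>x = exp (- t)\<close>, which compactifies the half-line,
  a function \<open>\<phi>\<close> of \<open>C_star\<close> is uniformly continuous on the unit interval, so that
  \<open>\<bar>\<phi> t - \<phi> \<xi>\<bar> \<le> \<epsilon> + C * (exp (- t) - exp (- \<xi>))\<^sup>2\<close>. For each \<open>s\<close> and \<open>\<xi>\<close>,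
  the map \<open>\<phi> \<mapsto> F_op F p R s \<phi> \<xi>\<close> is a positive linear functional. Applying it to this estimate in
  the variable \<open>t\<close> leaves, besides \<open>\<epsilon>\<close>, only the errors at the three test functions.\<close>

section \<open>The supremum norm on the half-line\<close>

lemma sup_norm_upper:
  assumes "bounded (f ` {0..})" and "\<xi> \<ge> 0"
  shows "\<bar>f \<xi>\<bar> \<le> sup_norm f"
proof -
  obtain B where "\<And>x. x \<ge> 0 \<Longrightarrow> \<bar>f x\<bar> \<le> B"
    using assms(1) by (auto simp: bounded_iff)
  then have "bdd_above ((\<lambda>\<xi>. \<bar>f \<xi>\<bar>) ` {0..})"
    by (auto intro!: bdd_aboveI2[where M = B])
  then show ?thesis
    unfolding sup_norm_def using assms(2) by (intro cSUP_upper) auto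
qed

lemma sup_norm_least:
  assumes "\<And>\<xi>. \<xi> \<ge> 0 \<Longrightarrow> \<bar>f \<xi>\<bar> \<le> B"
  shows "sup_norm f \<le> B"
  unfolding sup_norm_def using assms by (intro cSUP_least) auto

lemma sup_norm_nonneg:
  assumes "bounded (f ` {0..})"
  shows "sup_norm f \<ge> 0"
  using sup_norm_upper[OF assms, of 0] by linarith

section \<open>Linear combinations in \<open>C_star\<close> and the test functions\<close>

lemma C_star_lincomb:
  assumes "f \<in> C_star" and "g \<in> C_star"
  shows "(\<lambda>t. a * f t + b * g t) \<in> C_star"
proof -
  obtain L L' where "continuous_on {0..} f" "(f \<longlongrightarrow> L) at_top"
    and "continuous_on {0..} g" "(g \<longlongrightarrow> L') at_top"
    using assms by (auto simp: C_star_def)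
  then have "continuous_on {0..} (\<lambda>t. a * f t + b * g t)"
    and "((\<lambda>t. a * f t + b * g t) \<longlongrightarrow> a * L + b * L') at_top"
    by (auto intro!: continuous_on_add continuous_on_mult_left tendsto_add tendsto_mult_left)
  then show ?thesis
    by (auto simp: C_star_def)
qed

lemma test_fun_0: "test_fun 0 = (\<lambda>t. 1)"
  by (simp add: test_fun_def fun_eq_iff)

lemma test_fun_2: "test_fun 2 t = (test_fun 1 t)\<^sup>2"
  by (simp add: test_fun_def exp_double[symmetric])

lemma test_fun_bounds:
  assumes "t \<ge> 0"
  shows "0 \<le> test_fun \<nu> t" and "test_fun \<nu> t \<le> 1"
  using assms by (auto simp: test_fun_def)

lemma test_fun_C_star: "test_fun \<nu> \<in> C_star"
proof (cases "\<nu> = 0")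
  case True
  then show ?thesis
    by (auto simp: test_fun_0 C_star_def)
next
  case False
  then have "((\<lambda>t. exp (- (real \<nu> * t))) \<longlongrightarrow> 0) at_top"
    by (intro filterlim_compose[OF exp_at_bot] filterlim_compose[OF filterlim_uminus_at_bot_at_top]
        filterlim_tendsto_pos_mult_at_top[OF tendsto_const] filterlim_ident) auto
  then have "(test_fun \<nu> \<longlongrightarrow> 0) at_top"
    by (simp add: test_fun_def[abs_def])
  moreover have "continuous_on {0..} (test_fun \<nu>)"
    unfolding test_fun_def[abs_def] by (intro continuous_intros)
  ultimately show ?thesis
    by (auto simp: C_star_def)
qed

section \<open>Compactification of the half-line and a quadratic modulus of continuity\<close>

text \<open>The map \<open>t \<mapsto> exp (- t)\<close> carries the half-line onto the interval
  from 0 (excluded) to 1, and the limit of \<open>\<phi>\<close> at infinity is the value that makes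
  \<open>g\<close> continuous at the added point 0.\<close>

lemma C_star_compactify:
  assumes "\<phi> \<in> C_star"
  obtains g where "continuous_on {0..1} g" and "\<And>t. t \<ge> 0 \<Longrightarrow> \<phi> t = g (exp (- t))"
proof -
  obtain L where cont: "continuous_on {0..} \<phi>" and L: "(\<phi> \<longlongrightarrow> L) at_top"
    using assms by (auto simp: C_star_def)
  define g where "g x = (if x = 0 then L else \<phi> (- ln x))" for x :: real
  have "continuous (at x within {0..1}) g" if "x \<in> {0..1}" for x
  proof (cases "x = 0")
    case True
    have "((\<lambda>x. \<phi> (- ln x)) \<longlongrightarrow> L) (at_right 0)"
      by (intro filterlim_compose[OF L] filterlim_compose[OF filterlim_uminus_at_top_at_bot]
          ln_at_0)
    then have "(g \<longlongrightarrow> L) (at_right 0)"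
      by (rule Lim_transform_eventually)
        (auto simp: g_def eventually_at_filter)
    then have "(g \<longlongrightarrow> L) (at 0 within {0..1})"
      by (simp add: at_within_Icc_at_right)
    then show ?thesis
      using True by (simp add: continuous_within g_def)
  next
    case False
    have "continuous_on {0<..1} (\<lambda>x. \<phi> (- ln x))"
      by (intro continuous_on_compose2[OF cont] continuous_intros) auto
    then have "continuous_on {0<..1} g"
      by (rule continuous_on_eq) (auto simp: g_def)
    then have "continuous (at x within {0<..1}) g"
      using that False by (simp add: continuous_on_eq_continuous_within)
    \<comment> \<open>Since \<open>x > 0\<close>, the open set \<open>{0<..}\<close> is a
      neighbourhood of \<open>x\<close> on which the two intervals agree.\<close>
    moreover have "at x within {0<..1} = at x within {0..1}"
      using that False by (intro at_within_nhd[of _ "{0<..}"]) auto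
    ultimately show ?thesis
      by (simp add: continuous_within)
  qed
  then have "continuous_on {0..1} g"
    by (simp add: continuous_on_eq_continuous_within)
  moreover have "\<phi> t = g (exp (- t))" for t
    by (simp add: g_def)
  ultimately show thesis
    using that by blast
qed

lemma C_star_bounded:
  assumes "\<phi> \<in> C_star"
  obtains K where "K \<ge> 0" and "\<And>t. t \<ge> 0 \<Longrightarrow> \<bar>\<phi> t\<bar> \<le> K"
proof -
  obtain g where g: "continuous_on {0..1} g" "\<And>t. t \<ge> 0 \<Longrightarrow> \<phi> t = g (exp (- t))"
    using C_star_compactify[OF assms] by blast
  have "bounded (g ` {0..1})"
    using g(1) by (intro compact_imp_bounded compact_continuous_image) auto
  then obtain K where K: "K > 0" "\<And>x. x \<in> {0..1} \<Longrightarrow> \<bar>g x\<bar> \<le> K"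
    by (auto simp: bounded_pos)
  show thesis
    by (rule that[of K]) (use K g(2) in auto)
qed

text \<open>If \<open>exp (- t)\<close> and \<open>exp (- \<xi>)\<close> are close, uniform
  continuity of \<open>g\<close> gives the bound \<epsilon>; if not, the square is bounded below and
  a large multiple of it exceeds any difference of values of \<phi>. The constant \<open>C\<close>
  depends on neither \<open>t\<close> nor \<xi>, which later makes the convergence uniform in
  \<xi>.\<close>

lemma C_star_modulus:
  assumes "\<phi> \<in> C_star" and "\<epsilon> > 0"
  obtains C where "C \<ge> 0"
    and "\<And>t \<xi>. \<lbrakk>t \<ge> 0; \<xi> \<ge> 0\<rbrakk> \<Longrightarrow>
      \<bar>\<phi> t - \<phi> \<xi>\<bar> \<le> \<epsilon> + C * (test_fun 1 t - test_fun 1 \<xi>)\<^sup>2"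
proof -
  obtain g where g: "continuous_on {0..1} g" "\<And>t. t \<ge> 0 \<Longrightarrow> \<phi> t = g (exp (- t))"
    using C_star_compactify[OF assms(1)] by blast
  obtain K where K: "K \<ge> 0" "\<And>t. t \<ge> 0 \<Longrightarrow> \<bar>\<phi> t\<bar> \<le> K"
    using C_star_bounded[OF assms(1)] by blast
  have "uniformly_continuous_on {0..1} g"
    using g(1) by (intro compact_uniformly_continuous) auto
  then obtain \<delta> where \<delta>: "\<delta> > 0"
    "\<And>x y. \<lbrakk>x \<in> {0..1}; y \<in> {0..1}; \<bar>x - y\<bar> < \<delta>\<rbrakk> \<Longrightarrow> \<bar>g x - g y\<bar> < \<epsilon>"
    using assms(2) unfolding uniformly_continuous_on_def dist_real_def by metis
  show thesis
  \<comment> \<open>At distance at least \<delta> the square divided by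
    \<open>\<delta>\<^sup>2\<close> is at least 1, so this constant brings in the trivial bound
    \<open>2 * K\<close>.\<close>
  proof (rule that[of "2 * K / \<delta>\<^sup>2"])
    fix t \<xi> :: real
    assume t: "t \<ge> 0" and \<xi>: "\<xi> \<ge> 0"
    let ?d = "test_fun 1 t - test_fun 1 \<xi>"
    show "\<bar>\<phi> t - \<phi> \<xi>\<bar> \<le> \<epsilon> + 2 * K / \<delta>\<^sup>2 * ?d\<^sup>2"
    proof (cases "\<bar>?d\<bar> < \<delta>")
      case True
      then have "\<bar>\<phi> t - \<phi> \<xi>\<bar> < \<epsilon>"
        using \<delta>(2)[of "exp (- t)" "exp (- \<xi>)"] t \<xi> by (simp add: g(2) test_fun_def)
      moreover have "0 \<le> 2 * K / \<delta>\<^sup>2 * ?d\<^sup>2"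
        using K(1) by simp
      ultimately show ?thesis
        by linarith
    next
      case False
      then have "\<delta>\<^sup>2 \<le> ?d\<^sup>2"
        using \<delta>(1) by (intro abs_le_square_iff[THEN iffD1]) auto
      then have "1 \<le> ?d\<^sup>2 / \<delta>\<^sup>2"
        using \<delta>(1) by simp
      then have "2 * K * 1 \<le> 2 * K * (?d\<^sup>2 / \<delta>\<^sup>2)"
        using K(1) by (intro mult_left_mono) auto
      moreover have "\<bar>\<phi> t - \<phi> \<xi>\<bar> \<le> 2 * K"
        using K(2)[OF t] K(2)[OF \<xi>] by linarith
      ultimately show ?thesis
        using assms(2) by simp
    qed
  qed (use K(1) in simp)
qed

section \<open>Positive linear functionals on \<open>C_star\<close>\<close>

text \<open>Evaluation at a fixed \<xi> turns each of \<open>R m\<close>, \<open>V_op\<close> and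
  \<open>F_op\<close> into such a functional, so Korovkin's argument can be carried out once, with
  no reference to series or integrals.\<close>

definition positive_functional :: "((real \<Rightarrow> real) \<Rightarrow> real) \<Rightarrow> bool" where
  "positive_functional L \<longleftrightarrow>
     (\<forall>f\<in>C_star. \<forall>g\<in>C_star. \<forall>a b. L (\<lambda>t. a * f t + b * g t) = a * L f + b * L g) \<and>
     (\<forall>f\<in>C_star. (\<forall>t\<ge>0. f t \<ge> 0) \<longrightarrow> L f \<ge> 0)"

lemma positive_functional_lincomb:
  assumes "positive_functional L" and "f \<in> C_star" and "g \<in> C_star"
  shows "L (\<lambda>t. a * f t + b * g t) = a * L f + b * L g"
  using assms by (auto simp: positive_functional_def)

lemma positive_functional_nonneg:
  assumes "positive_functional L" and "f \<in> C_star" and "\<And>t. t \<ge> 0 \<Longrightarrow> f t \<ge> 0"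
  shows "L f \<ge> 0"
  using assms by (auto simp: positive_functional_def)

text \<open>Both \<open>g + f\<close> and \<open>g - f\<close> are non-negative; the sign
  \<open>c\<close> treats the two at once.\<close>

lemma positive_functional_abs_le:
  assumes L: "positive_functional L" and f: "f \<in> C_star" and g: "g \<in> C_star"
    and le: "\<And>t. t \<ge> 0 \<Longrightarrow> \<bar>f t\<bar> \<le> g t"
  shows "\<bar>L f\<bar> \<le> L g"
proof -
  \<comment> \<open>The factor 1 keeps the function literally in the shape of a linear combination,
    so that linearity can be applied by rewriting.\<close>
  have "0 \<le> L (\<lambda>t. 1 * g t + c * f t)" if "\<bar>c\<bar> = 1" for c
  proof -
    have "0 \<le> 1 * g t + c * f t" if "t \<ge> 0" for t
    proof -
      have "\<bar>c * f t\<bar> \<le> g t"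
        using le[OF that] \<open>\<bar>c\<bar> = 1\<close> by (simp add: abs_mult)
      then show ?thesis by linarith
    qed
    then show ?thesis
      by (rule positive_functional_nonneg[OF L C_star_lincomb[OF g f]])
  qed
  from this[of 1] this[of "-1"] show ?thesis
    unfolding positive_functional_lincomb[OF L g f] by (simp add: abs_le_iff)
qed

lemma positive_functional_bound:
  assumes L: "positive_functional L" and f: "f \<in> C_star"
    and K: "\<And>t. t \<ge> 0 \<Longrightarrow> \<bar>f t\<bar> \<le> K"
  shows "\<bar>L f\<bar> \<le> K * L (test_fun 0)"
proof -
  note z = test_fun_C_star[of 0]
  have "\<bar>L f\<bar> \<le> L (\<lambda>t. K * test_fun 0 t + 0 * test_fun 0 t)"
    by (intro positive_functional_abs_le[OF L f] C_star_lincomb z) (use K in \<open>simp add: test_fun_0\<close>)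
  then show ?thesis
    by (simp only: positive_functional_lincomb[OF L z z])
qed

section \<open>Korovkin's argument for positive functionals\<close>

text \<open>With \<xi> frozen, the square \<open>(test_fun 1 t - test_fun 1 \<xi>)\<^sup>2\<close>
  is a combination of the three test functions in \<open>t\<close>, so \<open>L\<close> of it is
  computed from their images. The coefficients involve powers of \<open>test_fun 1 \<xi>\<close>,
  which are at most 1, so \<xi> does not enter the resulting bound.\<close>

lemma korovkin_functional_estimate:
  assumes L: "positive_functional L" and \<phi>: "\<phi> \<in> C_star" and \<xi>: "\<xi> \<ge> 0"
    and C: "C \<ge> 0"
    and est: "\<And>t. t \<ge> 0 \<Longrightarrow> \<bar>\<phi> t - \<phi> \<xi>\<bar> \<le> \<epsilon> + C * (test_fun 1 t - test_fun 1 \<xi>)\<^sup>2"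
    and \<epsilon>: "\<epsilon> \<ge> 0" and K: "\<bar>\<phi> \<xi>\<bar> \<le> K"
    and N: "\<And>\<nu>. \<nu> \<in> {0, 1, 2} \<Longrightarrow> \<bar>L (test_fun \<nu>) - test_fun \<nu> \<xi>\<bar> \<le> N \<nu>"
  shows "\<bar>L \<phi> - \<phi> \<xi>\<bar> \<le> \<epsilon> * (1 + N 0) + C * (N 2 + 2 * N 1 + N 0) + K * N 0"
proof -
  let ?T = "test_fun" and ?e = "test_fun 1 \<xi>"
  note tc = test_fun_C_star
  note lin = positive_functional_lincomb[OF L]
  let ?h = "\<lambda>t. 1 * \<phi> t + (- \<phi> \<xi>) * ?T 0 t"
  \<comment> \<open>This is the majorant from \<open>est\<close> with the square expanded, nested so
    that two uses of binary linearity evaluate \<open>L\<close> on it.\<close>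
  let ?q = "\<lambda>t. (\<epsilon> + C * ?e\<^sup>2) * ?T 0 t + C * (1 * ?T 2 t + (- 2 * ?e) * ?T 1 t)"
  have q: "(\<lambda>t. 1 * ?T 2 t + (- 2 * ?e) * ?T 1 t) \<in> C_star"
    by (intro C_star_lincomb tc)
  have "\<bar>L ?h\<bar> \<le> L ?q"
  proof (rule positive_functional_abs_le[OF L C_star_lincomb[OF \<phi> tc] C_star_lincomb[OF tc q]])
    fix t :: real
    assume "t \<ge> 0"
    have "?q t = \<epsilon> + C * (?T 1 t - ?e)\<^sup>2"
      by (simp add: test_fun_0 test_fun_2 power2_eq_square algebra_simps)
    then show "\<bar>?h t\<bar> \<le> ?q t"
      using est[OF \<open>t \<ge> 0\<close>] by (simp add: test_fun_0)
  qed
  moreover have "L ?h = L \<phi> - \<phi> \<xi> * L (?T 0)"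
    by (simp only: lin[OF \<phi> tc])
  \<comment> \<open>The square vanishes at \<open>t = \<xi>\<close>, so the values subtracted here
    from the images of the test functions cancel in total, and only errors remain beside the
    \<epsilon> term.\<close>
  moreover have "L ?q = \<epsilon> * L (?T 0) + C * ((L (?T 2) - ?T 2 \<xi>) - 2 * ?e * (L (?T 1) - ?e)
      + ?e\<^sup>2 * (L (?T 0) - ?T 0 \<xi>))"
    by (simp only: lin[OF tc q] lin[OF tc tc])
      (simp add: test_fun_0 test_fun_2 power2_eq_square algebra_simps)
  ultimately have main: "\<bar>L \<phi> - \<phi> \<xi> * L (?T 0)\<bar> \<le> \<epsilon> * L (?T 0) +
      C * ((L (?T 2) - ?T 2 \<xi>) - 2 * ?e * (L (?T 1) - ?e) + ?e\<^sup>2 * (L (?T 0) - ?T 0 \<xi>))"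
    by simp
  have N0: "\<bar>L (?T 0) - 1\<bar> \<le> N 0" "\<bar>L (?T 1) - ?e\<bar> \<le> N 1" "\<bar>L (?T 2) - ?T 2 \<xi>\<bar> \<le> N 2"
    using N[of 0] N[of 1] N[of 2] by (auto simp: test_fun_0)
  have e: "0 \<le> ?e" "?e \<le> 1"
    using test_fun_bounds[OF \<xi>] by auto
  have "\<bar>?e * (L (?T 1) - ?e)\<bar> \<le> 1 * N 1"
    unfolding abs_mult using e N0(2) by (intro mult_mono) auto
  moreover have "\<bar>?e\<^sup>2 * (L (?T 0) - ?T 0 \<xi>)\<bar> \<le> 1 * N 0"
    unfolding abs_mult using e N0(1) by (intro mult_mono) (auto simp: test_fun_0 power_le_one)
  ultimately have "(L (?T 2) - ?T 2 \<xi>) - 2 * ?e * (L (?T 1) - ?e) + ?e\<^sup>2 * (L (?T 0) - ?T 0 \<xi>)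
      \<le> N 2 + 2 * N 1 + N 0"
    using N0(3) by linarith
  then have "C * ((L (?T 2) - ?T 2 \<xi>) - 2 * ?e * (L (?T 1) - ?e) + ?e\<^sup>2 * (L (?T 0) - ?T 0 \<xi>))
      \<le> C * (N 2 + 2 * N 1 + N 0)"
    using C by (rule mult_left_mono)
  moreover have "\<epsilon> * L (?T 0) \<le> \<epsilon> * (1 + N 0)"
    using N0(1) \<epsilon> by (intro mult_left_mono) auto
  moreover have "\<bar>\<phi> \<xi> * (L (?T 0) - 1)\<bar> \<le> K * N 0"
    unfolding abs_mult using K N0(1) by (intro mult_mono) auto
  \<comment> \<open>\<open>L\<close> need not fix the constant 1; the second summand corrects for
    this and contributes \<open>K * N 0\<close>.\<close>
  moreover have "L \<phi> - \<phi> \<xi> = (L \<phi> - \<phi> \<xi> * L (?T 0)) + \<phi> \<xi> * (L (?T 0) - 1)"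
    by (simp add: algebra_simps)
  ultimately show ?thesis
    using main by linarith
qed

text \<open>The pointwise estimate does not depend on \<xi>, so it bounds the supremum norm. As
  \<open>s\<close> grows the errors at the test functions vanish and only \<epsilon> is
  left.\<close>

lemma korovkin_functionals:
  fixes L :: "real \<Rightarrow> (real \<Rightarrow> real) \<Rightarrow> real \<Rightarrow> real"
  assumes L: "\<And>s \<xi>. \<lbrakk>s \<ge> 0; \<xi> \<ge> 0\<rbrakk> \<Longrightarrow> positive_functional (\<lambda>f. L s f \<xi>)"
    and bdd: "\<And>s. s \<ge> 0 \<Longrightarrow> bounded (L s (test_fun 0) ` {0..})"
    and test: "\<And>\<nu>. \<nu> \<in> {0, 1, 2} \<Longrightarrow>
      ((\<lambda>s. sup_norm (\<lambda>\<xi>. L s (test_fun \<nu>) \<xi> - test_fun \<nu> \<xi>)) \<longlongrightarrow> 0) at_top"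
    and \<phi>: "\<phi> \<in> C_star"
  shows "((\<lambda>s. sup_norm (\<lambda>\<xi>. L s \<phi> \<xi> - \<phi> \<xi>)) \<longlongrightarrow> 0) at_top"
proof -
  define N where "N \<nu> s = sup_norm (\<lambda>\<xi>. L s (test_fun \<nu>) \<xi> - test_fun \<nu> \<xi>)" for \<nu> s
  \<comment> \<open>\<open>sup_norm\<close> is a real supremum, meaningful for bounded functions
    only. Positivity carries boundedness from the image of \<open>test_fun 0\<close> to the image of
    every \<open>f\<close>.\<close>
  have bdd_diff: "bounded ((\<lambda>\<xi>. L s f \<xi> - f \<xi>) ` {0..})" if f: "f \<in> C_star" and s: "s \<ge> 0" for f s
  proof -
    obtain B where B: "\<And>\<xi>. \<xi> \<ge> 0 \<Longrightarrow> \<bar>L s (test_fun 0) \<xi>\<bar> \<le> B"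
      using bdd[OF s] by (auto simp: bounded_iff)
    obtain K where K: "K \<ge> 0" "\<And>t. t \<ge> 0 \<Longrightarrow> \<bar>f t\<bar> \<le> K"
      using C_star_bounded[OF f] by blast
    have "\<bar>L s f \<xi> - f \<xi>\<bar> \<le> K * B + K" if \<xi>: "\<xi> \<ge> 0" for \<xi>
    proof -
      have "\<bar>L s f \<xi>\<bar> \<le> K * L s (test_fun 0) \<xi>"
        using K(2) by (rule positive_functional_bound[OF L[OF s \<xi>] f])
      also have "\<dots> \<le> K * B"
        using K(1) B[OF \<xi>] by (intro mult_left_mono) auto
      finally show ?thesis
        using K(2)[OF \<xi>] by linarith
    qed
    then show ?thesis
      by (auto simp: bounded_iff)
  qed
  have Nlim: "(N \<nu> \<longlongrightarrow> 0) at_top" if "\<nu> \<in> {0, 1, 2}" for \<nu>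
    using test[OF that] unfolding N_def .
  obtain K where K: "\<And>t. t \<ge> 0 \<Longrightarrow> \<bar>\<phi> t\<bar> \<le> K"
    using C_star_bounded[OF \<phi>] by blast
  show ?thesis
  proof (rule tendstoI)
    fix e :: real
    assume e: "e > 0"
    \<comment> \<open>The bound \<open>U s\<close> below tends to \<epsilon>, which must lie
      strictly below \<open>e\<close>.\<close>
    define \<epsilon> where "\<epsilon> = e / 2"
    have \<epsilon>: "\<epsilon> > 0" "\<epsilon> < e"
      using e by (auto simp: \<epsilon>_def)
    obtain C where C: "C \<ge> 0" "\<And>t \<xi>. \<lbrakk>t \<ge> 0; \<xi> \<ge> 0\<rbrakk> \<Longrightarrow>
        \<bar>\<phi> t - \<phi> \<xi>\<bar> \<le> \<epsilon> + C * (test_fun 1 t - test_fun 1 \<xi>)\<^sup>2"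
      using C_star_modulus[OF \<phi> \<epsilon>(1)] by blast
    define U where "U s = \<epsilon> * (1 + N 0 s) + C * (N 2 s + 2 * N 1 s + N 0 s) + K * N 0 s" for s
    have "(U \<longlongrightarrow> \<epsilon> * (1 + 0) + C * (0 + 2 * 0 + 0) + K * 0) at_top"
      unfolding U_def by (intro tendsto_intros Nlim) auto
    then have "\<forall>\<^sub>F s in at_top. U s < e"
      using \<epsilon>(2) by (intro order_tendstoD(2)) auto
    then show "\<forall>\<^sub>F s in at_top. dist (sup_norm (\<lambda>\<xi>. L s \<phi> \<xi> - \<phi> \<xi>)) 0 < e"
      using eventually_ge_at_top[of 0]
    proof eventually_elim
      case (elim s)
      have "\<bar>L s \<phi> \<xi> - \<phi> \<xi>\<bar> \<le> U s" if \<xi>: "\<xi> \<ge> 0" for \<xi>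
        unfolding U_def
        using sup_norm_upper[OF bdd_diff[OF test_fun_C_star elim(2)] \<xi>] C(2) \<epsilon>(1) K \<xi>
        by (intro korovkin_functional_estimate[OF L[OF elim(2) \<xi>] \<phi> \<xi> C(1),
              where N = "\<lambda>\<nu>. N \<nu> s"]) (auto simp: N_def)
      then have "sup_norm (\<lambda>\<xi>. L s \<phi> \<xi> - \<phi> \<xi>) \<le> U s"
        by (rule sup_norm_least)
      then show ?case
        using elim(1) sup_norm_nonneg[OF bdd_diff[OF \<phi> elim(2)]] by simp
    qed
  qed
qed

section \<open>Positive operators and the power series of the method\<close>

lemma positive_functional_op:
  assumes "positive_linear_op T" and "\<xi> \<ge> 0"
  shows "positive_functional (\<lambda>f. T f \<xi>)"
  using assms by (simp add: positive_linear_op_def positive_functional_def)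

text \<open>Positivity lets the image of the constant 1 control every other image. A condition on
  \<open>test_fun 0\<close> alone thus majorizes the series for each \<open>f\<close>.\<close>

lemma op_bound:
  assumes T: "positive_linear_op T" and f: "f \<in> C_star"
    and K: "K \<ge> 0" "\<And>t. t \<ge> 0 \<Longrightarrow> \<bar>f t\<bar> \<le> K" and \<xi>: "\<xi> \<ge> 0"
  shows "\<bar>T f \<xi>\<bar> \<le> K * sup_norm (T (test_fun 0))"
proof -
  have "bounded (T (test_fun 0) ` {0..})"
    using T test_fun_C_star by (auto simp: positive_linear_op_def B_star_def)
  then have "\<bar>T (test_fun 0) \<xi>\<bar> \<le> sup_norm (T (test_fun 0))"
    using \<xi> by (rule sup_norm_upper)
  then have "K * T (test_fun 0) \<xi> \<le> K * sup_norm (T (test_fun 0))"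
    using K(1) by (intro mult_left_mono) auto
  then show ?thesis
    using positive_functional_bound[OF positive_functional_op[OF T \<xi>] f K(2)] by linarith
qed

lemma op_norm_nonneg:
  assumes "positive_linear_op T"
  shows "sup_norm (T (test_fun 0)) \<ge> 0"
  using assms test_fun_C_star by (intro sup_norm_nonneg) (auto simp: positive_linear_op_def B_star_def)

lemma borel_type_nonneg: "borel_type p \<Longrightarrow> p m \<ge> 0"
  by (cases "m = 0") (auto simp: borel_type_def)

lemma pseries_pos:
  assumes "borel_type p" and "y \<ge> 0"
  shows "pseries p y > 0"
proof -
  have "summable (\<lambda>m. p m * y ^ m)"
    using assms by (intro summable_in_conv_radius) (auto simp: borel_type_def)
  moreover have "p 0 * y ^ 0 > 0"
    using assms by (simp add: borel_type_def)
  ultimately show ?thesis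
    unfolding pseries_def using assms borel_type_nonneg[OF assms(1)]
    by (intro suminf_pos2[where i = 0]) auto
qed

section \<open>The boundedness condition in real terms\<close>

text \<open>\<open>M\<close> is a real bound replacing the extended-real supremum. The point
  \<open>y = 0\<close> is included so that later statements hold on all of \<open>{0..}\<close>, the
  domain of integration, with no exceptional null set.\<close>

locale borel_type_method =
  fixes p :: "nat \<Rightarrow> real" and R :: "nat \<Rightarrow> (real \<Rightarrow> real) \<Rightarrow> real \<Rightarrow> real" and M :: real
  assumes p: "borel_type p" and R: "\<And>m. positive_linear_op (R m)"
    and M: "M \<ge> 0"
    and majorant_summable:
      "\<And>y. y \<ge> 0 \<Longrightarrow> summable (\<lambda>m. sup_norm (R m (test_fun 0)) * p m * y ^ m)"
    and majorant_le: "\<And>y. y \<ge> 0 \<Longrightarrow>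
      1 / pseries p y * (\<Sum>m. sup_norm (R m (test_fun 0)) * p m * y ^ m) \<le> M"

text \<open>For \<open>y > 0\<close> the factor \<open>1 / pseries p y\<close> is positive, so a
  finite supremum forces the extended-real sum to be finite; as its terms are non-negative, the real
  series then converges to the same value.\<close>

lemma borel_type_method_exists:
  assumes p: "borel_type p" and R: "\<And>m. positive_linear_op (R m)"
    and fin: "(SUP y\<in>{0<..}. ennreal (1 / pseries p y) *
            (\<Sum>m. ennreal (sup_norm (R m (test_fun 0)) * p m * y ^ m))) < \<infinity>"
  obtains M where "borel_type_method p R M"
proof -
  let ?a = "\<lambda>y m. sup_norm (R m (test_fun 0)) * p m * y ^ m"
  let ?S = "SUP y\<in>{0<..}. ennreal (1 / pseries p y) * (\<Sum>m. ennreal (?a y m))"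
  obtain M where M: "M \<ge> 0" "?S = ennreal M"
    using fin by (cases ?S) auto
  have a: "?a y m \<ge> 0" if "y \<ge> 0" for y m
    using that op_norm_nonneg[OF R] borel_type_nonneg[OF p] by simp
  have pos: "summable (?a y) \<and> 1 / pseries p y * (\<Sum>m. ?a y m) \<le> M" if y: "y > 0" for y
  proof
    have py: "pseries p y > 0"
      using pseries_pos[OF p] y by simp
    have le: "ennreal (1 / pseries p y) * (\<Sum>m. ennreal (?a y m)) \<le> ennreal M"
      unfolding M(2)[symmetric] using y by (intro SUP_upper) auto
    have "(\<Sum>m. ennreal (?a y m)) \<noteq> top"
    proof
      assume "(\<Sum>m. ennreal (?a y m)) = top"
      then have "ennreal (1 / pseries p y) * (\<Sum>m. ennreal (?a y m)) = top"
        using py by (simp add: ennreal_mult_top)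
      with le show False
        by (simp add: top_unique)
    qed
    then show sum: "summable (?a y)"
      using a y by (intro summable_suminf_not_top) auto
    have "ennreal (1 / pseries p y * (\<Sum>m. ?a y m)) \<le> ennreal M"
      using le py a y sum suminf_nonneg[OF sum]
      by (simp add: ennreal_mult[symmetric] suminf_ennreal2)
    then show "1 / pseries p y * (\<Sum>m. ?a y m) \<le> M"
      using M(1) by simp
  qed
  \<comment> \<open>At \<open>y = 0\<close>, outside the range of the supremum, only the term of
    index 0 survives; the maximum in \<open>M'\<close> accounts for its value.\<close>
  have zero: "summable (?a 0)"
    by (rule summable_finite[of "{0}"]) auto
  define M' where "M' = max M (1 / pseries p 0 * (\<Sum>m. ?a 0 m))"
  show thesis
  proof (rule that[of M'], unfold_locales)
    show "borel_type p" and "positive_linear_op (R m)" for m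
      by (fact p, fact R)
    show "M' \<ge> 0"
      using M(1) by (simp add: M'_def)
    fix y :: real
    assume "y \<ge> 0"
    then show "summable (?a y)" and "1 / pseries p y * (\<Sum>m. ?a y m) \<le> M'"
      using pos[of y] zero by (cases "y = 0"; force simp: M'_def)+
  qed
qed

section \<open>The power series means as positive functionals\<close>

context borel_type_method
begin

lemma V_term_bound:
  assumes "f \<in> C_star" and "K \<ge> 0" "\<And>t. t \<ge> 0 \<Longrightarrow> \<bar>f t\<bar> \<le> K" and "\<xi> \<ge> 0" and "y \<ge> 0"
  shows "\<bar>R m f \<xi> * p m * y ^ m\<bar> \<le> K * (sup_norm (R m (test_fun 0)) * p m * y ^ m)"
proof -
  have "\<bar>R m f \<xi>\<bar> * (p m * y ^ m) \<le> K * sup_norm (R m (test_fun 0)) * (p m * y ^ m)"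
    using op_bound[OF R assms(1-4)] borel_type_nonneg[OF p] \<open>y \<ge> 0\<close>
    by (intro mult_right_mono) auto
  then show ?thesis
    using borel_type_nonneg[OF p] \<open>y \<ge> 0\<close> by (simp add: abs_mult mult.assoc)
qed

lemma V_summable:
  assumes f: "f \<in> C_star" and "\<xi> \<ge> 0" and "y \<ge> 0"
  shows "summable (\<lambda>m. R m f \<xi> * p m * y ^ m)"
proof -
  obtain K where K: "K \<ge> 0" "\<And>t. t \<ge> 0 \<Longrightarrow> \<bar>f t\<bar> \<le> K"
    using C_star_bounded[OF f] by blast
  show ?thesis
    by (rule summable_comparison_test'[OF summable_mult[OF majorant_summable[OF \<open>y \<ge> 0\<close>]]])
      (use V_term_bound[OF f K] assms in auto)
qed

text \<open>Termwise comparison with the majorant series. The bound is free of both \<open>y\<close>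
  and \<xi>: the first gives integrability against the kernel, the second boundedness of the
  integrals in \<xi>.\<close>

lemma V_bound:
  assumes f: "f \<in> C_star" and K: "K \<ge> 0" "\<And>t. t \<ge> 0 \<Longrightarrow> \<bar>f t\<bar> \<le> K"
    and \<xi>: "\<xi> \<ge> 0" and y: "y \<ge> 0"
  shows "\<bar>V_op p R y f \<xi>\<bar> \<le> K * M"
proof -
  let ?a = "\<lambda>m. sup_norm (R m (test_fun 0)) * p m * y ^ m"
  have py: "pseries p y > 0"
    using pseries_pos[OF p y] .
  have "\<bar>\<Sum>m. R m f \<xi> * p m * y ^ m\<bar> \<le> (\<Sum>m. K * ?a m)"
    using norm_suminf_le[OF V_term_bound[OF f K \<xi> y, folded real_norm_def]
        summable_mult[OF majorant_summable[OF y]]] by simp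
  also have "\<dots> = K * (\<Sum>m. ?a m)"
    by (rule suminf_mult[OF majorant_summable[OF y]])
  finally have "\<bar>V_op p R y f \<xi>\<bar> \<le> K * (1 / pseries p y * (\<Sum>m. ?a m))"
    using py by (simp add: V_op_def abs_mult divide_right_mono)
  also have "\<dots> \<le> K * M"
    using K(1) majorant_le[OF y] by (rule mult_left_mono[rotated])
  finally show ?thesis .
qed

text \<open>Both properties pass from the operators \<open>R m\<close> to the series because it
  converges, by \<open>V_summable\<close>; the weights \<open>p m * y ^ m\<close> are
  non-negative.\<close>

lemma V_positive_functional:
  assumes "\<xi> \<ge> 0" and "y \<ge> 0"
  shows "positive_functional (\<lambda>f. V_op p R y f \<xi>)"
  unfolding positive_functional_def
proof (intro conjI ballI allI impI)
  fix f g :: "real \<Rightarrow> real" and a b :: real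
  assume f: "f \<in> C_star" and g: "g \<in> C_star"
  have R_lin: "R m (\<lambda>t. a * f t + b * g t) \<xi> = a * R m f \<xi> + b * R m g \<xi>" for m
    by (rule positive_functional_lincomb[OF positive_functional_op[OF R \<open>\<xi> \<ge> 0\<close>] f g])
  have "(\<lambda>m. R m (\<lambda>t. a * f t + b * g t) \<xi> * p m * y ^ m) =
      (\<lambda>m. a * (R m f \<xi> * p m * y ^ m) + b * (R m g \<xi> * p m * y ^ m))"
    by (rule ext) (simp only: R_lin, simp add: algebra_simps)
  moreover have "(\<lambda>m. a * (R m f \<xi> * p m * y ^ m) + b * (R m g \<xi> * p m * y ^ m)) sums
      (a * (\<Sum>m. R m f \<xi> * p m * y ^ m) + b * (\<Sum>m. R m g \<xi> * p m * y ^ m))"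
    by (intro sums_add sums_mult summable_sums V_summable f g assms)
  ultimately have "(\<Sum>m. R m (\<lambda>t. a * f t + b * g t) \<xi> * p m * y ^ m) =
      a * (\<Sum>m. R m f \<xi> * p m * y ^ m) + b * (\<Sum>m. R m g \<xi> * p m * y ^ m)"
    by (simp only: sums_iff)
  then show "V_op p R y (\<lambda>t. a * f t + b * g t) \<xi> = a * V_op p R y f \<xi> + b * V_op p R y g \<xi>"
    unfolding V_op_def by (simp only:) (simp add: add_divide_distrib)
next
  fix f :: "real \<Rightarrow> real"
  assume f: "f \<in> C_star" and nn: "\<forall>t\<ge>0. 0 \<le> f t"
  have "R m f \<xi> \<ge> 0" for m
    using positive_functional_op[OF R \<open>\<xi> \<ge> 0\<close>, of m] f nn by (simp add: positive_functional_def)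
  then have "0 \<le> (\<Sum>m. R m f \<xi> * p m * y ^ m)"
    using V_summable[OF f assms] borel_type_nonneg[OF p] \<open>y \<ge> 0\<close> by (intro suminf_nonneg) auto
  then show "0 \<le> V_op p R y f \<xi>"
    using pseries_pos[OF p \<open>y \<ge> 0\<close>] by (simp add: V_op_def)
qed

section \<open>Integration against the kernel\<close>

text \<open>For fixed \<xi> this is a quotient of two series of monomials in \<open>y\<close>, hence
  Borel; completion and restriction preserve measurability.\<close>

lemma V_measurable: "(\<lambda>y. V_op p R y f \<xi>) \<in> borel_measurable (lebesgue_on {0..})"
proof -
  have "(\<lambda>y. V_op p R y f \<xi>) \<in> borel_measurable borel"
    unfolding V_op_def pseries_def by measurable
  then show ?thesis
    by (intro measurable_restrict_space1 measurable_completion) simp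
qed

text \<open>By \<open>V_bound\<close>, the product is dominated by the constant multiple
  \<open>K * M\<close> of the integrable function \<open>F s\<close>.\<close>

lemma F_V_integrable:
  assumes F: "integrable (lebesgue_on {0..}) (F s)" and f: "f \<in> C_star" and \<xi>: "\<xi> \<ge> 0"
  shows "integrable (lebesgue_on {0..}) (\<lambda>y. F s y * V_op p R y f \<xi>)"
proof -
  obtain K where K: "K \<ge> 0" "\<And>t. t \<ge> 0 \<Longrightarrow> \<bar>f t\<bar> \<le> K"
    using C_star_bounded[OF f] by blast
  show ?thesis
  proof (rule Bochner_Integration.integrable_bound)
    show "integrable (lebesgue_on {0..}) (\<lambda>y. F s y * (K * M))"
      using F by simp
    show "(\<lambda>y. F s y * V_op p R y f \<xi>) \<in> borel_measurable (lebesgue_on {0..})"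
      using F V_measurable by (intro borel_measurable_times) auto
    show "AE y in lebesgue_on {0..}. norm (F s y * V_op p R y f \<xi>) \<le> norm (F s y * (K * M))"
      using V_bound[OF f K \<xi>] K(1) M
      by (intro AE_I2) (auto simp: abs_mult intro!: mult_left_mono)
  qed
qed

text \<open>Linearity of the integral rests on integrability of both summands, given by
  \<open>F_V_integrable\<close>; positivity comes from the non-negative kernel.\<close>

lemma F_positive_functional:
  assumes F: "integrable (lebesgue_on {0..}) (F s)" and nn: "\<And>y. y \<ge> 0 \<Longrightarrow> F s y \<ge> 0"
    and \<xi>: "\<xi> \<ge> 0"
  shows "positive_functional (\<lambda>f. F_op F p R s f \<xi>)"
  unfolding positive_functional_def
proof (intro conjI ballI allI impI)
  fix f g :: "real \<Rightarrow> real" and a b :: real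
  assume f: "f \<in> C_star" and g: "g \<in> C_star"
  have "F_op F p R s (\<lambda>t. a * f t + b * g t) \<xi> =
      (\<integral>y. a * (F s y * V_op p R y f \<xi>) + b * (F s y * V_op p R y g \<xi>) \<partial>(lebesgue_on {0..}))"
    unfolding F_op_def integral_method_def
    by (intro Bochner_Integration.integral_cong refl)
      (simp add: positive_functional_lincomb[OF V_positive_functional[OF \<xi>] f g] algebra_simps)
  also have "\<dots> = a * F_op F p R s f \<xi> + b * F_op F p R s g \<xi>"
    unfolding F_op_def integral_method_def
    using F_V_integrable[where F = F and s = s, OF F f \<xi>] F_V_integrable[where F = F and s = s, OF F g \<xi>] by simp
  finally show "F_op F p R s (\<lambda>t. a * f t + b * g t) \<xi> =
      a * F_op F p R s f \<xi> + b * F_op F p R s g \<xi>" .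
next
  fix f :: "real \<Rightarrow> real"
  assume "f \<in> C_star" and "\<forall>t\<ge>0. 0 \<le> f t"
  then show "0 \<le> F_op F p R s f \<xi>"
    unfolding F_op_def integral_method_def
    using V_positive_functional[OF \<xi>] nn
    by (intro Bochner_Integration.integral_nonneg) (simp add: positive_functional_def)
qed

text \<open>The dominating integral of \<open>F s y * M\<close> does not involve \<xi>. This
  supplies the boundedness premise of \<open>korovkin_functionals\<close>.\<close>

lemma F_bounded:
  assumes F: "integrable (lebesgue_on {0..}) (F s)" and nn: "\<And>y. y \<ge> 0 \<Longrightarrow> F s y \<ge> 0"
  shows "bounded (F_op F p R s (test_fun 0) ` {0..})"
proof -
  have "\<bar>F_op F p R s (test_fun 0) \<xi>\<bar> \<le> (\<integral>y. F s y * M \<partial>(lebesgue_on {0..}))" if \<xi>: "\<xi> \<ge> 0" for \<xi>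
  proof -
    have V: "\<bar>V_op p R y (test_fun 0) \<xi>\<bar> \<le> M" if "y \<ge> 0" for y
      using V_bound[OF test_fun_C_star[of 0], of 1 \<xi> y] \<xi> that by (simp add: test_fun_0)
    show ?thesis
      unfolding F_op_def integral_method_def real_norm_def[symmetric]
      by (rule Bochner_Integration.integral_norm_bound_integral[OF F_V_integrable[where F = F and s = s, OF F test_fun_C_star \<xi>]])
        (use F nn V in \<open>auto simp: abs_mult intro!: mult_left_mono\<close>)
  qed
  then show ?thesis
    by (auto simp: bounded_iff)
qed

end

theorem theorem4:
  fixes F :: "real \<Rightarrow> real \<Rightarrow> real"
    and p :: "nat \<Rightarrow> real"
    and R :: "nat \<Rightarrow> (real \<Rightarrow> real) \<Rightarrow> real \<Rightarrow> real"
  assumes "integral_method_kernel F"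
    and "nonnegative_method F"
    and "regular_method F"
    and "borel_type p"
    and "\<And>m. positive_linear_op (R m)"
    and "(SUP y\<in>{0<..}. ennreal (1 / pseries p y) *
            (\<Sum>m. ennreal (sup_norm (R m (test_fun 0)) * p m * y ^ m))) < \<infinity>"
    and "\<And>\<nu>. \<nu> \<in> {0, 1, 2} \<Longrightarrow>
           ((\<lambda>s. sup_norm (\<lambda>\<xi>. F_op F p R s (test_fun \<nu>) \<xi> - test_fun \<nu> \<xi>)) \<longlongrightarrow> 0) at_top"
  shows "\<forall>\<phi>\<in>C_star.
           ((\<lambda>s. sup_norm (\<lambda>\<xi>. F_op F p R s \<phi> \<xi> - \<phi> \<xi>)) \<longlongrightarrow> 0) at_top"
proof
  fix \<phi> :: "real \<Rightarrow> real"
  assume \<phi>: "\<phi> \<in> C_star"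
  obtain M where "borel_type_method p R M"
    by (rule borel_type_method_exists[OF assms(4-6)])
  then interpret borel_type_method p R M .
  have F: "integrable (lebesgue_on {0..}) (F s)" "\<And>y. y \<ge> 0 \<Longrightarrow> F s y \<ge> 0" if "s \<ge> 0" for s
    using assms(1,2) that by (auto simp: integral_method_kernel_def nonnegative_method_def)
  \<comment> \<open>The abstract Korovkin statement is applied to the family
    \<open>F_op F p R s\<close>.\<close>
  show "((\<lambda>s. sup_norm (\<lambda>\<xi>. F_op F p R s \<phi> \<xi> - \<phi> \<xi>)) \<longlongrightarrow> 0) at_top"
  proof (rule korovkin_functionals)
    show "positive_functional (\<lambda>f. F_op F p R s f \<xi>)" if "s \<ge> 0" and "\<xi> \<ge> 0" for s \<xi>
      by (rule F_positive_functional[where F = F and s = s]) (use F that in auto)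
    show "bounded (F_op F p R s (test_fun 0) ` {0..})" if "s \<ge> 0" for s
      by (rule F_bounded[where F = F and s = s]) (use F that in auto)
  qed (use assms(7) \<phi> in auto)
qed

end
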